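(* Let $\mathcal H$ be a real Hilbert space, $p\geq 1$, and let $\mathcal J:\mathcal H\to\mathbb R\cup\{+\infty\}$ be proper, convex, lower semicontinuous and absolutely $p$-homogeneous. Assume that the sublevel sets of $\|\cdot\|+\mathcal J(\cdot)$ are precompact and that there is a constant $C_p>0$ with $$\|u-P_{\mathcal N_{\mathcal J}}u\|^p\le C_p\,\mathcal J(u)\qquad\forall u\in\mathcal H.$$ Let $w_0\in\mathcal N_{\mathcal J}^\perp$ with $\|w_0\|=1$ and $\mathcal J(w_0)<\infty$, let $0<c<1$, and let $(w_k)_{k\in\mathbb N}$ be generated by $$w_{k+1}=\frac{\mathrm{prox}_{\sigma_k\mathcal J}(w_k)}{\|\mathrm{prox}_{\sigma_k\mathcal J}(w_k)\|},\qquad k\ge0,$$ where the step sizes are chosen either as $\sigma_k:=\frac{c}{\mathcal J(w_0)}$ for all $k\ge0$ (constant rule) or as $\sigma_k:=\frac{c}{\mathcal J(w_k)}$ for all $k\ge0$ (variable rule). Then $(w_k)_{k\in\mathbb N}$ admits a subsequence converging to some $w_\infty\in\mathcal N_{\mathcal J}^\perp$ which satisfies $$\mu w_\infty=\mathrm{prox}_{\sigma(w_\infty)\mathcal J}(w_\infty)$$ with some $\mu\in(0,1)$, where $\sigma(w_\infty)=\frac{c}{\mathcal J(w_0)}$ for the constant rule and $\sigma(w_\infty)=\frac{c}{\mathcal J(w_\infty)}$ for the variable rule.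
   Context: $\mathcal J$ is absolutely $p$-homogeneous if $\mathcal J(0)=0$ and $\mathcal J(cu)=|c|^p\mathcal J(u)$ for $c\ne0$. The null space $\mathcal N_{\mathcal J}=\{u:\mathcal J(u)=0\}$ is a closed linear subspace, with orthogonal complement $\mathcal N_{\mathcal J}^\perp$ and orthogonal projection $P_{\mathcal N_{\mathcal J}}$. For $\sigma>0$, $\mathrm{prox}_{\sigma\mathcal J}(w):=\arg\min_{u\in\mathcal H}\frac12\|u-w\|^2+\sigma\mathcal J(u)$. *)

theory Defs
  imports "HOL-Analysis.Analysis"
begin

(* Functionals with values in R \<union> {+\<infinity>} are rendered as ereal-valued functions; the value
   -\<infinity> is excluded by proper. *)

definition proper :: "('a \<Rightarrow> ereal) \<Rightarrow> bool"
  where "proper J \<longleftrightarrow> (\<forall>u. J u \<noteq> -\<infinity>) \<and> (\<exists>u. J u \<noteq> \<infinity>)"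

(* The library's convex_on covers real-valued functions only.
   In ereal 0 * \<infinity> = 0, so the endpoints t = 0 and t = 1 impose no condition. *)
definition convex_functional :: "('a::real_vector \<Rightarrow> ereal) \<Rightarrow> bool"
  where "convex_functional J \<longleftrightarrow>
    (\<forall>x y. \<forall>t\<in>{0..1}.
       J ((1 - t) *\<^sub>R x + t *\<^sub>R y) \<le> ereal (1 - t) * J x + ereal t * J y)"

definition lower_semicontinuous :: "('a::topological_space \<Rightarrow> ereal) \<Rightarrow> bool"
  where "lower_semicontinuous J \<longleftrightarrow> (\<forall>u. J u \<le> Liminf (at u) J)"

definition abs_homogeneous :: "real \<Rightarrow> ('a::real_vector \<Rightarrow> ereal) \<Rightarrow> bool"
  where "abs_homogeneous p J \<longleftrightarrow>
    J 0 = 0 \<and> (\<forall>c u. c \<noteq> 0 \<longrightarrow> J (c *\<^sub>R u) = ereal (\<bar>c\<bar> powr p) * J u)"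

definition null_space :: "('a \<Rightarrow> ereal) \<Rightarrow> 'a set"
  where "null_space J = {u. J u = 0}"

(* Determined when S is a closed linear subspace of a Hilbert space. The library's closest_point
   requires a Heine-Borel space, hence finite dimension. *)
definition orth_proj :: "'a::real_inner set \<Rightarrow> 'a \<Rightarrow> 'a"
  where "orth_proj S u = (THE v. v \<in> S \<and> u - v \<in> S\<^sup>\<bottom>)"

(* In a complete space a set is precompact iff its closure is compact. *)
definition precompact_sublevels :: "('a::topological_space \<Rightarrow> ereal) \<Rightarrow> bool"
  where "precompact_sublevels F \<longleftrightarrow> (\<forall>a::real. compact (closure {u. F u \<le> ereal a}))"

(* For \<sigma> > 0 and J proper, convex and lower semicontinuous on a Hilbert space the minimiser is
   unique, so the choice made by arg_min is immaterial. *)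
definition prox :: "real \<Rightarrow> ('a::real_normed_vector \<Rightarrow> ereal) \<Rightarrow> 'a \<Rightarrow> 'a"
  where "prox \<sigma> J w =
    (ARG_MIN (\<lambda>u. ereal (1 / 2 * (norm (u - w))\<^sup>2) + ereal \<sigma> * J u) u. True)"

end

theory Submission
  imports Defs
begin

text \<open>
  Let \<open>u\<close> be the proximal point of a unit vector \<open>w\<close>, and let \<open>s = norm u\<close>. The whole argument
  rests on comparing \<open>u\<close> with \<open>s w\<close>, the point of the ray through \<open>w\<close> that lies on the same sphere
  as \<open>u\<close> (lemma \<open>prox_same_radius\<close>). No point of this sphere is closer to \<open>w\<close>, so minimality of \<open>u\<close>
  forces \<open>J u \<le> J (s w) = s\<^sup>p J w\<close>, that is, \<open>J (u / s) \<le> J w\<close>: one step of the iteration does not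
  increase \<open>J\<close>. Quantitatively, \<open>\<parallel>u - s w\<parallel>\<^sup>2\<close> is at most \<open>2 \<sigma>\<close> times the decrease of \<open>J\<close>
  (lemma \<open>prox_step\<close>).

  Three further comparisons keep the iteration well defined and place it in a compact set. Adding an
  element of the null space does not increase \<open>J\<close>, so the proximal point of a vector orthogonal to
  the null space stays orthogonal to it (\<open>prox_orthogonal\<close>), and there the Poincare inequality bounds
  \<open>J\<close> on unit vectors from below by \<open>1 / C\<close>. Comparing zero with \<open>(1 - c) w\<close> shows that \<open>u\<close> does not
  vanish as long as \<open>\<sigma> J w \<le> c < 1\<close> (\<open>prox_nonzero\<close>); both step size rules guarantee this bound
  because \<open>J\<close> decreases. Comparing \<open>u\<close> with \<open>t u\<close> for \<open>t < 1\<close> gives \<open>s < 1\<close> (\<open>norm_prox_less_1\<close>).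

  Along the iteration the values \<open>J (w\<^sub>k)\<close> therefore decrease to some \<open>L > 0\<close>, the step sizes converge
  to some \<open>\<tau> > 0\<close>, and \<open>u\<^sub>k - s\<^sub>k w\<^sub>k\<close> tends to zero. The pairs \<open>(w\<^sub>k, s\<^sub>k)\<close> have a subsequence with a
  limit \<open>(l, \<mu>)\<close>, along which \<open>u\<^sub>k\<close> tends to \<open>\<mu> l\<close> and \<open>J (u\<^sub>k)\<close> to \<open>\<mu>\<^sup>p L\<close>. Passing to the limit in the
  minimality of \<open>u\<^sub>k\<close> yields that \<open>\<mu> l\<close> is the proximal point of \<open>l\<close> for the parameter \<open>\<tau>\<close>, and also
  that \<open>J l = L\<close>: lower semicontinuity gives \<open>J l \<le> L\<close>, and testing the limit inequality with \<open>\<mu> l\<close>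
  itself gives the converse (\<open>prox_iteration_converges\<close>). The identity \<open>J l = L\<close> is what identifies
  \<open>\<tau>\<close> with \<open>c / J l\<close> under the variable rule.
\<close>

section \<open>Limits, orthogonality and lower semicontinuity\<close>

lemma norm_diff_unit:
  fixes u w :: "'a::real_inner"
  assumes "norm w = 1" shows "(norm (u - w))\<^sup>2 = (norm u)\<^sup>2 - 2 * (u \<bullet> w) + 1"
proof -
  have "w \<bullet> w = 1" using assms by (simp flip: power2_norm_eq_inner)
  then show ?thesis
    unfolding power2_norm_eq_inner by (simp add: inner_diff_left inner_diff_right inner_commute)
qed

lemma orthogonal_scale: "u \<in> S\<^sup>\<bottom> \<Longrightarrow> t *\<^sub>R u \<in> S\<^sup>\<bottom>" for u :: "'a::real_inner"
  unfolding orthogonal_comp_def orthogonal_def by simp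

lemma orthogonal_limit:
  fixes x :: "nat \<Rightarrow> 'a::real_inner"
  assumes "x \<longlonglongrightarrow> l" and "\<And>n. x n \<in> S\<^sup>\<bottom>"
  shows "l \<in> S\<^sup>\<bottom>"
proof -
  have "y \<bullet> l = 0" if "y \<in> S" for y
  proof -
    have "(\<lambda>n. y \<bullet> x n) \<longlonglongrightarrow> y \<bullet> l" by (intro tendsto_intros assms(1))
    moreover have "y \<bullet> x n = 0" for n
      using assms(2) that unfolding orthogonal_comp_def orthogonal_def by auto
    ultimately show ?thesis by (simp add: LIMSEQ_const_iff)
  qed
  then show ?thesis unfolding orthogonal_comp_def orthogonal_def by auto
qed

text \<open>The limit inferior excludes the point itself, but the excluded value at \<open>u\<close> satisfies the same
  strict bound, so every strict superlevel set is a neighbourhood of each of its points.\<close>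

lemma lsc_limit:
  assumes lsc: "lower_semicontinuous F"
    and x: "x \<longlonglongrightarrow> u" and a: "a \<longlonglongrightarrow> b" and le: "\<And>n. F (x n) \<le> ereal (a n)"
  shows "F u \<le> ereal b"
proof (rule ccontr)
  assume "\<not> F u \<le> ereal b"
  then obtain e where e: "ereal b < ereal e" "ereal e < F u"
    by (meson ereal_dense2 not_le)
  have "ereal e < Liminf (at u) F"
    using e(2) lsc unfolding lower_semicontinuous_def by (blast intro: less_le_trans)
  then have "\<forall>\<^sub>F v in at u. ereal e < F v"
    by (rule less_LiminfD)
  then have "\<forall>\<^sub>F v in nhds u. ereal e < F v"
    using e(2) by (auto simp: eventually_at_filter elim: eventually_mono)
  then have "\<forall>\<^sub>F n in sequentially. ereal e < F (x n)"
    using x by (rule eventually_compose_filterlim)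
  moreover have "\<forall>\<^sub>F n in sequentially. a n < e"
    using a e(1) by (auto dest: order_tendstoD)
  ultimately have "\<forall>\<^sub>F n in sequentially. False"
    by eventually_elim (use less_le_trans[OF _ le] in force)
  then show False by simp
qed

section \<open>Absolutely homogeneous functionals with a Poincare inequality\<close>

locale poincare_functional =
  fixes J :: "'a::{real_inner, complete_space} \<Rightarrow> ereal" and p C :: real
  assumes p_ge_1: "p \<ge> 1"
    and convex: "convex_functional J"
    and lsc: "lower_semicontinuous J"
    and homogeneous: "abs_homogeneous p J"
    and precompact: "precompact_sublevels (\<lambda>u. ereal (norm u) + J u)"
    and C_pos: "C > 0"
    and poincare: "\<And>u. ereal (norm (u - orth_proj (null_space J) u) powr p) \<le> ereal C * J u"
begin

definition eff_dom :: "'a set" where "eff_dom = {u. J u < \<infinity>}"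

text \<open>Calculations are carried out with real values; \<open>val\<close> is only meaningful on \<open>eff_dom\<close> and has the
  default value zero outside it.\<close>

definition val :: "'a \<Rightarrow> real" where "val u = real_of_ereal (J u)"

text \<open>The left-hand side of the Poincare inequality is nonnegative, and \<open>C > 0\<close>.\<close>

lemma J_nonneg: "0 \<le> J u"
proof -
  have "0 \<le> ereal C * J u"
    by (rule order_trans[OF _ poincare[of u]]) simp
  then show ?thesis
    using C_pos by (cases "J u") (auto simp: zero_le_mult_iff)
qed

lemma J_eq_val: "u \<in> eff_dom \<Longrightarrow> J u = ereal (val u)"
  using J_nonneg[of u] unfolding eff_dom_def val_def by (cases "J u") auto

lemma domI: "J u \<le> ereal a \<Longrightarrow> u \<in> eff_dom"
  unfolding eff_dom_def by (auto intro: le_less_trans)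

lemma val_le: "J u \<le> ereal a \<Longrightarrow> val u \<le> a"
  using J_eq_val[OF domI] by fastforce

lemma val_nonneg: "0 \<le> val u"
  using J_nonneg[of u] unfolding val_def by (simp add: real_of_ereal_pos)

text \<open>The case \<open>t = 0\<close> is included because \<open>0 powr p = 0\<close> and \<open>0 * \<infinity> = 0\<close> for extended reals.\<close>

lemma J_scale: "0 \<le> t \<Longrightarrow> J (t *\<^sub>R u) = ereal (t powr p) * J u"
  using homogeneous unfolding abs_homogeneous_def
  by (cases "t = 0") (auto simp flip: zero_ereal_def)

lemma scale_dom: "0 \<le> t \<Longrightarrow> u \<in> eff_dom \<Longrightarrow> t *\<^sub>R u \<in> eff_dom"
  using J_scale[of t u] J_eq_val[of u] by (intro domI[of _ "t powr p * val u"]) simp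

lemma val_scale: "0 \<le> t \<Longrightarrow> val (t *\<^sub>R u) = t powr p * val u"
  using J_scale[of t u] unfolding val_def by simp

lemma zero_dom: "0 \<in> eff_dom"
  using homogeneous unfolding abs_homogeneous_def eff_dom_def by simp

lemma val_zero: "val 0 = 0"
  using homogeneous unfolding abs_homogeneous_def val_def by simp

lemma J_convex_le:
  assumes "u \<in> eff_dom" "v \<in> eff_dom" "0 \<le> t" "t \<le> 1"
  shows "J ((1 - t) *\<^sub>R u + t *\<^sub>R v) \<le> ereal ((1 - t) * val u + t * val v)"
proof -
  have "J ((1 - t) *\<^sub>R u + t *\<^sub>R v) \<le> ereal (1 - t) * J u + ereal t * J v"
    using convex assms(3,4) unfolding convex_functional_def by auto
  then show ?thesis
    using assms(1,2) by (simp add: J_eq_val)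
qed

lemma powr_le_self:
  assumes "0 \<le> t" "t \<le> 1" shows "t powr p \<le> t"
  using powr_mono'[OF p_ge_1 assms] assms by simp

lemma null_space_scale: "n \<in> null_space J \<Longrightarrow> t *\<^sub>R n \<in> null_space J"
  using homogeneous unfolding abs_homogeneous_def null_space_def
  by (cases "t = 0") auto

text \<open>Writing \<open>u + n = (1 - t) (u / (1 - t)) + t (n / t)\<close>, convexity bounds the value by
  \<open>(1 - t) powr (1 - p) * val u\<close>, and \<open>t\<close> may tend to zero.\<close>

lemma add_null_space:
  assumes u: "u \<in> eff_dom" and n: "n \<in> null_space J"
  shows "u + n \<in> eff_dom" "val (u + n) \<le> val u"
proof -
  have le: "J (u + n) \<le> ereal ((1 - t) * ((1 / (1 - t)) powr p * val u))"
    if t: "0 < t" "t < 1" for t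
  proof -
    have n': "(1 / t) *\<^sub>R n \<in> null_space J"
      by (rule null_space_scale[OF n])
    then have d: "(1 / t) *\<^sub>R n \<in> eff_dom" "val ((1 / t) *\<^sub>R n) = 0"
      unfolding null_space_def eff_dom_def val_def by auto
    have "u + n = (1 - t) *\<^sub>R ((1 / (1 - t)) *\<^sub>R u) + t *\<^sub>R ((1 / t) *\<^sub>R n)"
      using t by simp
    then have "J (u + n) \<le> ereal ((1 - t) * val ((1 / (1 - t)) *\<^sub>R u) + t * val ((1 / t) *\<^sub>R n))"
      using J_convex_le[OF scale_dom[OF _ u] d(1), of "1 / (1 - t)" t] t by simp
    moreover have "val ((1 / (1 - t)) *\<^sub>R u) = (1 / (1 - t)) powr p * val u"
      using t by (intro val_scale) simp
    ultimately show ?thesis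
      using d(2) by simp
  qed
  show "u + n \<in> eff_dom"
    using le[of "1/2"] domI by simp
  have "((\<lambda>t. (1 - t) * ((1 / (1 - t)) powr p * val u)) \<longlongrightarrow> (1 - 0) * ((1 / (1 - 0)) powr p * val u))
      (at_right 0)"
    by (intro tendsto_intros) auto
  moreover have "\<forall>\<^sub>F t in at_right 0. val (u + n) \<le> (1 - t) * ((1 / (1 - t)) powr p * val u)"
    unfolding eventually_at_right_field using le val_le by (intro exI[of _ 1]) auto
  ultimately show "val (u + n) \<le> val u"
    using tendsto_lowerbound[OF _ _ trivial_limit_at_right_real] by fastforce
qed

text \<open>On the orthogonal complement the projection vanishes, because zero already satisfies its
  defining property; so there the Poincare inequality bounds the norm itself.\<close>

lemma poincare_orthogonal:
  assumes u: "u \<in> (null_space J)\<^sup>\<bottom>" and d: "u \<in> eff_dom"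
  shows "norm u powr p \<le> C * val u"
proof -
  have 0: "0 \<in> null_space J"
    using homogeneous unfolding abs_homogeneous_def null_space_def by simp
  have "orth_proj (null_space J) u = 0"
    unfolding orth_proj_def
  proof (rule the_equality)
    fix v assume v: "v \<in> null_space J \<and> u - v \<in> (null_space J)\<^sup>\<bottom>"
    then have "v \<bullet> u = 0" "v \<bullet> (u - v) = 0"
      using u unfolding orthogonal_comp_def orthogonal_def by auto
    then show "v = 0"
      by (simp add: inner_diff_right)
  qed (use 0 u in simp)
  then show ?thesis
    using poincare[of u] J_eq_val[OF d] by simp
qed

lemma val_pos_orthogonal:
  assumes "u \<in> (null_space J)\<^sup>\<bottom>" "u \<in> eff_dom" "u \<noteq> 0"
  shows "0 < val u"
proof -
  have "0 < norm u powr p" using assms(3) by simp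
  also have "\<dots> \<le> C * val u" by (rule poincare_orthogonal[OF assms(1,2)])
  finally show ?thesis using C_pos by (simp add: zero_less_mult_iff)
qed

section \<open>The proximal operator\<close>

definition energy :: "real \<Rightarrow> 'a \<Rightarrow> 'a \<Rightarrow> real"
  where "energy \<sigma> w u = 1 / 2 * (norm (u - w))\<^sup>2 + \<sigma> * val u"

lemma ereal_energy:
  "u \<in> eff_dom \<Longrightarrow> ereal (1 / 2 * (norm (u - w))\<^sup>2) + ereal \<sigma> * J u = ereal (energy \<sigma> w u)"
  by (simp add: J_eq_val energy_def)

definition minimizes :: "real \<Rightarrow> 'a \<Rightarrow> 'a \<Rightarrow> bool"
  where "minimizes \<sigma> w u \<longleftrightarrow> u \<in> eff_dom \<and> (\<forall>v\<in>eff_dom. energy \<sigma> w u \<le> energy \<sigma> w v)"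

lemma compact_bounded_sublevel:
  "compact (closure {u. ereal (norm u) + J u \<le> ereal a})"
  using precompact unfolding precompact_sublevels_def by blast

text \<open>The direct method: the energy bounds both the norm and \<open>J\<close>, so a minimizing sequence lies in one
  of the precompact sublevel sets, and lower semicontinuity makes every cluster point a minimizer.\<close>

lemma minimizer_exists:
  assumes \<sigma>: "\<sigma> > 0"
  shows "\<exists>u. minimizes \<sigma> w u"
proof -
  define m where "m = Inf (energy \<sigma> w ` eff_dom)"
  have bdd: "bdd_below (energy \<sigma> w ` eff_dom)"
    using \<sigma> val_nonneg by (intro bdd_belowI2[of _ 0]) (simp add: energy_def)
  have m_le: "m \<le> energy \<sigma> w v" if "v \<in> eff_dom" for v
    unfolding m_def using bdd that by (intro cInf_lower) auto
  have "\<exists>v\<in>eff_dom. energy \<sigma> w v < m + 1 / real (Suc n)" for n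
    using cInf_lessD[of "energy \<sigma> w ` eff_dom" "m + 1 / real (Suc n)"] zero_dom
    unfolding m_def by auto
  then obtain v where v: "\<And>n. v n \<in> eff_dom" "\<And>n. energy \<sigma> w (v n) < m + 1 / real (Suc n)"
    by metis
  \<comment> \<open>Terms of the sequence satisfy \<open>\<parallel>v - w\<parallel>\<^sup>2 \<le> 2 (m + 1)\<close>; combined with \<open>x \<le> x\<^sup>2 + 1\<close> this bounds
      \<open>\<parallel>v\<parallel>\<close>. The last summand bounds \<open>J v\<close>.\<close>
  define B where "B = norm w + (2 * (m + 1) + 1) + (m + 1) / \<sigma>"
  have "v n \<in> closure {u. ereal (norm u) + J u \<le> ereal B}" for n
  proof -
    have E: "1 / 2 * (norm (v n - w))\<^sup>2 + \<sigma> * val (v n) \<le> m + 1"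
    proof -
      have "1 / real (Suc n) \<le> 1" by simp
      then show ?thesis using v(2)[of n] unfolding energy_def by linarith
    qed
    have "0 \<le> \<sigma> * val (v n)" using \<sigma> val_nonneg by simp
    then have "(norm (v n - w))\<^sup>2 \<le> 2 * (m + 1)" using E by simp
    moreover have "norm (v n - w) \<le> (norm (v n - w))\<^sup>2 + 1"
    proof -
      have "2 * norm (v n - w) \<le> (norm (v n - w))\<^sup>2 + 1"
        using zero_le_power2[of "norm (v n - w) - 1"] by (simp add: power2_diff)
      then show ?thesis using norm_ge_zero[of "v n - w"] by linarith
    qed
    ultimately have "norm (v n) \<le> norm w + (2 * (m + 1) + 1)"
      using norm_triangle_sub[of "v n" w] by linarith
    moreover have "val (v n) \<le> (m + 1) / \<sigma>"
    proof -
      have "\<sigma> * val (v n) \<le> m + 1"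
        using E zero_le_power2[of "norm (v n - w)"] by linarith
      then show ?thesis using \<sigma> by (simp add: pos_le_divide_eq mult.commute)
    qed
    ultimately have "ereal (norm (v n)) + J (v n) \<le> ereal B"
      using J_eq_val[OF v(1)] unfolding B_def by simp
    then show ?thesis
      by (intro subsetD[OF closure_subset] CollectI)
  qed
  then obtain l r where r: "strict_mono r" and l: "(v \<circ> r) \<longlonglongrightarrow> l"
    using seq_compactE[OF compact_imp_seq_compact[OF compact_bounded_sublevel[of B]], of v] by blast
  have rate: "(\<lambda>n. 1 / real (Suc (r n))) \<longlonglongrightarrow> 0"
    using LIMSEQ_subseq_LIMSEQ[OF LIMSEQ_inverse_real_of_nat r]
    by (simp add: o_def inverse_eq_divide)
  have lim: "(\<lambda>n. (m + 1 / real (Suc (r n)) - 1 / 2 * (norm (v (r n) - w))\<^sup>2) / \<sigma>)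
      \<longlonglongrightarrow> (m + 0 - 1 / 2 * (norm (l - w))\<^sup>2) / \<sigma>"
    using l \<sigma> unfolding o_def by (intro tendsto_intros rate) auto
  have "J (v (r n)) \<le> ereal ((m + 1 / real (Suc (r n)) - 1 / 2 * (norm (v (r n) - w))\<^sup>2) / \<sigma>)" for n
    using v(2)[of "r n"] \<sigma> unfolding J_eq_val[OF v(1)] energy_def
    by (simp add: pos_le_divide_eq mult.commute)
  then have *: "J l \<le> ereal ((m - 1 / 2 * (norm (l - w))\<^sup>2) / \<sigma>)"
    using lsc_limit[OF lsc l lim] by simp
  then have "energy \<sigma> w l \<le> m"
    using val_le[OF *] \<sigma> unfolding energy_def by (simp add: pos_le_divide_eq mult.commute)
  then have "minimizes \<sigma> w l"
    unfolding minimizes_def using domI[OF *] m_le by force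
  then show ?thesis ..
qed

lemma prox_minimizes:
  assumes \<sigma>: "\<sigma> > 0"
  shows "minimizes \<sigma> w (prox \<sigma> J w)"
proof -
  let ?F = "\<lambda>u. ereal (1 / 2 * (norm (u - w))\<^sup>2) + ereal \<sigma> * J u"
  obtain u where u: "u \<in> eff_dom" "\<And>v. v \<in> eff_dom \<Longrightarrow> energy \<sigma> w u \<le> energy \<sigma> w v"
    using minimizer_exists[OF \<sigma>] unfolding minimizes_def by blast
  have inf: "?F v = \<infinity>" if "v \<notin> eff_dom" for v
    using that \<sigma> unfolding eff_dom_def by simp
  have le: "?F u \<le> ?F v" for v
  proof (cases "v \<in> eff_dom")
    case True
    then show ?thesis by (simp only: ereal_energy u ereal_less_eq)
  next
    case False
    show ?thesis by (simp only: inf[OF False] ereal_less_eq)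
  qed
  then have "is_arg_min ?F (\<lambda>_. True) u"
    unfolding is_arg_min_def by (simp add: not_less)
  then have "is_arg_min ?F (\<lambda>_. True) (prox \<sigma> J w)"
    unfolding prox_def arg_min_def by (rule someI)
  then have min: "?F (prox \<sigma> J w) \<le> ?F v" for v
    unfolding is_arg_min_def by (simp add: not_less)
  have d: "prox \<sigma> J w \<in> eff_dom"
  proof (rule ccontr)
    assume "prox \<sigma> J w \<notin> eff_dom"
    from inf[OF this] min[of 0] show False
      by (simp only: ereal_energy[OF zero_dom]) simp
  qed
  show ?thesis
    unfolding minimizes_def
  proof (intro conjI ballI)
    fix v assume "v \<in> eff_dom"
    then show "energy \<sigma> w (prox \<sigma> J w) \<le> energy \<sigma> w v"
      using min[of v] by (simp only: ereal_energy d ereal_less_eq)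
  qed (rule d)
qed

text \<open>By convexity and the parallelogram law the energy at the midpoint of two minimizers falls short of
  their common energy by at least a multiple of their squared distance.\<close>

lemma minimizer_unique:
  assumes \<sigma>: "\<sigma> > 0" and a: "minimizes \<sigma> w a" and b: "minimizes \<sigma> w b"
  shows "a = b"
proof -
  let ?m = "(1 - 1 / 2) *\<^sub>R a + (1 / 2 :: real) *\<^sub>R b"
  have d: "a \<in> eff_dom" "b \<in> eff_dom" using a b unfolding minimizes_def by auto
  note J_le = J_convex_le[OF d, of "1 / 2", simplified]
  have dm: "?m \<in> eff_dom" using J_le domI by simp
  have "\<sigma> * val ?m \<le> \<sigma> * val a / 2 + \<sigma> * val b / 2"
    using mult_left_mono[OF val_le[OF J_le], of \<sigma>] \<sigma> by (simp add: algebra_simps)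
  moreover have "energy \<sigma> w a \<le> energy \<sigma> w ?m" "energy \<sigma> w b \<le> energy \<sigma> w ?m"
    using a b dm unfolding minimizes_def by auto
  moreover have "(norm (?m - w))\<^sup>2
      = (norm (a - w))\<^sup>2 / 2 + (norm (b - w))\<^sup>2 / 2 - (norm (a - b))\<^sup>2 / 4"
    unfolding power2_norm_eq_inner
    by (simp add: inner_add_left inner_add_right inner_diff_left inner_diff_right inner_commute
        field_simps)
  ultimately have "(norm (a - b))\<^sup>2 \<le> 0"
    unfolding energy_def by linarith
  then show ?thesis by simp
qed

lemma prox_eq:
  "\<sigma> > 0 \<Longrightarrow> minimizes \<sigma> w u \<Longrightarrow> prox \<sigma> J w = u"
  using minimizer_unique prox_minimizes by blast

lemma prox_dom: "\<sigma> > 0 \<Longrightarrow> prox \<sigma> J w \<in> eff_dom"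
  using prox_minimizes unfolding minimizes_def by blast

lemma prox_le: "\<sigma> > 0 \<Longrightarrow> v \<in> eff_dom \<Longrightarrow> energy \<sigma> w (prox \<sigma> J w) \<le> energy \<sigma> w v"
  using prox_minimizes unfolding minimizes_def by blast

text \<open>Moving along the null space does not increase \<open>J\<close>, so the proximal point has to be the closest
  point to \<open>w\<close> among its translates by the null space.\<close>

lemma prox_orthogonal:
  assumes \<sigma>: "\<sigma> > 0" and w: "w \<in> (null_space J)\<^sup>\<bottom>"
  shows "prox \<sigma> J w \<in> (null_space J)\<^sup>\<bottom>"
proof -
  let ?u = "prox \<sigma> J w"
  have "n \<bullet> ?u = 0" if n: "n \<in> null_space J" for n
  proof (rule ccontr)
    assume ne: "n \<bullet> ?u \<noteq> 0"
    then have n0: "n \<bullet> n > 0" by auto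
    have nw: "n \<bullet> w = 0"
      using w n unfolding orthogonal_comp_def orthogonal_def by auto
    \<comment> \<open>The step that minimizes the distance of \<open>?u + t n\<close> to \<open>w\<close>.\<close>
    define t where "t = - (n \<bullet> ?u) / (n \<bullet> n)"
    note tn = add_null_space[OF prox_dom[OF \<sigma>] null_space_scale[OF n], of w t]
    have "\<sigma> * val (?u + t *\<^sub>R n) \<le> \<sigma> * val ?u"
      using tn(2) \<sigma> by (intro mult_left_mono) auto
    then have "(norm (?u - w))\<^sup>2 \<le> (norm (?u + t *\<^sub>R n - w))\<^sup>2"
      using prox_le[OF \<sigma> tn(1), of w] unfolding energy_def by linarith
    also have "\<dots> = (norm (?u - w))\<^sup>2 + 2 * t * (n \<bullet> ?u) + t * t * (n \<bullet> n)"
      unfolding power2_norm_eq_inner using nw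
      by (simp add: inner_add_left inner_add_right inner_diff_left inner_diff_right inner_commute
          algebra_simps)
    also have "\<dots> = (norm (?u - w))\<^sup>2 - (n \<bullet> ?u)\<^sup>2 / (n \<bullet> n)"
      using n0 unfolding t_def by (simp add: power2_eq_square field_simps)
    finally have "(n \<bullet> ?u)\<^sup>2 / (n \<bullet> n) \<le> 0" by simp
    then show False using ne n0 by (simp add: divide_le_0_iff)
  qed
  then show ?thesis
    unfolding orthogonal_comp_def orthogonal_def by auto
qed

text \<open>Since \<open>t powr p \<le> t\<close>, twice the energy of \<open>t w\<close> is at most \<open>(1 - t)\<^sup>2 + 2 t c\<close>, whose minimum
  over \<open>t\<close> is attained at \<open>t = 1 - c\<close> and is smaller than \<open>1\<close>, twice the energy of zero.\<close>

lemma prox_nonzero: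
  assumes \<sigma>: "\<sigma> > 0" and w: "norm w = 1" "w \<in> eff_dom" and c: "\<sigma> * val w \<le> c" "c < 1"
  shows "prox \<sigma> J w \<noteq> 0"
proof
  assume 0: "prox \<sigma> J w = 0"
  have c0: "0 \<le> c" using c(1) \<sigma> val_nonneg[of w] by (meson mult_nonneg_nonneg less_imp_le order_trans)
  define t where "t = 1 - c"
  have t: "0 < t" "t \<le> 1" using c(2) c0 unfolding t_def by auto
  have "energy \<sigma> w 0 \<le> energy \<sigma> w (t *\<^sub>R w)"
    using prox_le[OF \<sigma> scale_dom[OF _ w(2), of t], of w] t 0 by simp
  then have "1 \<le> (norm (t *\<^sub>R w - w))\<^sup>2 + 2 * (\<sigma> * (t powr p * val w))"
    unfolding energy_def using t w by (simp add: val_scale val_zero)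
  also have "(norm (t *\<^sub>R w - w))\<^sup>2 = (1 - t)\<^sup>2"
    using w(1) norm_diff_unit[of w "t *\<^sub>R w"] t
    by (simp add: power2_norm_eq_inner[symmetric] power2_eq_square algebra_simps)
  also have "\<sigma> * (t powr p * val w) \<le> t * c"
  proof -
    have "\<sigma> * (t powr p * val w) = t powr p * (\<sigma> * val w)" by simp
    also have "\<dots> \<le> t * c"
      using powr_le_self[of t] t c(1) \<sigma> val_nonneg[of w] by (intro mult_mono) auto
    finally show ?thesis .
  qed
  finally have "1 \<le> (1 - t)\<^sup>2 + 2 * (t * c)" by simp
  then have "t * t \<le> 0" unfolding t_def by (simp add: power2_eq_square algebra_simps)
  then show False using t by (simp add: mult_le_0_iff)
qed

text \<open>First order optimality in the radial direction: compare the proximal point \<open>u\<close> with \<open>t u\<close>, divide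
  by \<open>1 - t\<close>, and let \<open>t\<close> tend to \<open>1\<close>. The bound \<open>t powr p \<le> t\<close> replaces the derivative of the power,
  at the price of the factor \<open>p\<close> in front of the value of \<open>J\<close>.\<close>

lemma prox_radial:
  assumes \<sigma>: "\<sigma> > 0" and w: "norm w = 1"
  shows "(norm (prox \<sigma> J w))\<^sup>2 + \<sigma> * val (prox \<sigma> J w) \<le> norm (prox \<sigma> J w)"
proof -
  let ?u = "prox \<sigma> J w" and ?s = "norm (prox \<sigma> J w)"
  have uw: "?u \<bullet> w \<le> ?s"
    using norm_cauchy_schwarz[of ?u w] w by simp
  have le: "(1 + t) / 2 * ?s\<^sup>2 + \<sigma> * val ?u \<le> ?s" if t: "0 < t" "t < 1" for t
  proof -
    have "energy \<sigma> w ?u \<le> energy \<sigma> w (t *\<^sub>R ?u)"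
      using prox_le[OF \<sigma> scale_dom[OF _ prox_dom[OF \<sigma>]]] t by simp
    also have "val (t *\<^sub>R ?u) \<le> t * val ?u"
      using t val_nonneg[of ?u] powr_le_self[of t] by (simp add: val_scale mult_right_mono)
    then have "\<sigma> * val (t *\<^sub>R ?u) \<le> \<sigma> * (t * val ?u)"
      using \<sigma> by (intro mult_left_mono) auto
    then have "energy \<sigma> w (t *\<^sub>R ?u) \<le> 1 / 2 * (norm (t *\<^sub>R ?u - w))\<^sup>2 + \<sigma> * (t * val ?u)"
      unfolding energy_def by simp
    finally have "(1 - t) * ((1 + t) / 2 * ?s\<^sup>2 + \<sigma> * val ?u) \<le> (1 - t) * (?u \<bullet> w)"
      unfolding energy_def norm_diff_unit[OF w] using t
      by (simp add: power_mult_distrib power2_eq_square field_simps)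
    then show ?thesis
      using t uw by simp
  qed
  have "((\<lambda>t. (1 + t) / 2 * ?s\<^sup>2 + \<sigma> * val ?u) \<longlongrightarrow> (1 + 1) / 2 * ?s\<^sup>2 + \<sigma> * val ?u) (at_left 1)"
    by (intro tendsto_intros) auto
  moreover have "\<forall>\<^sub>F t in at_left 1. (1 + t) / 2 * ?s\<^sup>2 + \<sigma> * val ?u \<le> ?s"
    unfolding eventually_at_left_field using le by (intro exI[of _ 0]) auto
  ultimately show ?thesis
    using tendsto_upperbound[OF _ _ trivial_limit_at_left_real] by fastforce
qed

lemma norm_prox_le_1:
  assumes "\<sigma> > 0" "norm w = 1" shows "norm (prox \<sigma> J w) \<le> 1"
proof (rule ccontr)
  assume "\<not> norm (prox \<sigma> J w) \<le> 1"
  then have "1 * norm (prox \<sigma> J w) < norm (prox \<sigma> J w) * norm (prox \<sigma> J w)"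
    by (intro mult_strict_right_mono) auto
  then have "norm (prox \<sigma> J w) < (norm (prox \<sigma> J w))\<^sup>2"
    by (simp only: power2_eq_square mult_1_left)
  moreover have "0 \<le> \<sigma> * val (prox \<sigma> J w)" using assms(1) val_nonneg by simp
  ultimately show False using prox_radial[OF assms] by linarith
qed

lemma norm_prox_less_1:
  assumes \<sigma>: "\<sigma> > 0" and w: "norm w = 1" "w \<in> (null_space J)\<^sup>\<bottom>"
  shows "norm (prox \<sigma> J w) < 1"
proof (rule ccontr)
  assume "\<not> ?thesis"
  then have 1: "norm (prox \<sigma> J w) = 1" using norm_prox_le_1[OF \<sigma> w(1)] by simp
  then have "0 < val (prox \<sigma> J w)"
    using val_pos_orthogonal[OF prox_orthogonal[OF \<sigma> w(2)] prox_dom[OF \<sigma>]] by force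
  then show False using prox_radial[OF \<sigma> w(1)] 1 \<sigma> by (simp add: mult_le_0_iff)
qed

text \<open>Compare the proximal point with \<open>s w\<close>, where \<open>s\<close> is its norm. In the difference of the two
  energies all squared norms cancel, and only the inner product with \<open>w\<close> remains.\<close>

lemma prox_same_radius:
  assumes \<sigma>: "\<sigma> > 0" and w: "norm w = 1" "w \<in> eff_dom"
  defines "s \<equiv> norm (prox \<sigma> J w)"
  shows "s - prox \<sigma> J w \<bullet> w + \<sigma> * val (prox \<sigma> J w) \<le> \<sigma> * (s powr p * val w)"
proof -
  have "energy \<sigma> w (prox \<sigma> J w) \<le> energy \<sigma> w (s *\<^sub>R w)"
    unfolding s_def by (intro prox_le[OF \<sigma>] scale_dom w(2)) simp
  moreover have "w \<bullet> w = 1" using w(1) by (simp flip: power2_norm_eq_inner)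
  ultimately show ?thesis
    unfolding energy_def norm_diff_unit[OF w(1)] using w(1)
    by (simp add: s_def val_scale algebra_simps)
qed

section \<open>The normalized proximal iteration\<close>

definition prox_step :: "real \<Rightarrow> 'a \<Rightarrow> 'a"
  where "prox_step \<sigma> w = (1 / norm (prox \<sigma> J w)) *\<^sub>R prox \<sigma> J w"

text \<open>The set that the iteration never leaves.\<close>

definition sphere_dom :: "'a set"
  where "sphere_dom = {w \<in> (null_space J)\<^sup>\<bottom>. norm w = 1 \<and> w \<in> eff_dom}"

lemma val_sphere_lower: "w \<in> sphere_dom \<Longrightarrow> 1 / C \<le> val w"
  using poincare_orthogonal[of w] C_pos unfolding sphere_dom_def
  by (simp add: divide_le_eq mult.commute)

text \<open>By the Cauchy-Schwarz inequality, \<open>s - u \<bullet> w\<close> is nonnegative, so \<open>prox_same_radius\<close> bounds it by a multiple of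
  the decrease of \<open>J\<close>, and up to the factor \<open>2 s\<close> it is the squared distance of \<open>u\<close> to \<open>s w\<close>.\<close>

lemma prox_step:
  assumes \<sigma>: "\<sigma> > 0" and w: "w \<in> sphere_dom" and c: "\<sigma> * val w \<le> c" "c < 1"
  defines "s \<equiv> norm (prox \<sigma> J w)"
  shows "prox_step \<sigma> w \<in> sphere_dom"
    and "val (prox \<sigma> J w) = s powr p * val (prox_step \<sigma> w)"
    and "val (prox_step \<sigma> w) \<le> val w"
    and "(norm (prox \<sigma> J w - s *\<^sub>R w))\<^sup>2 \<le> 2 * (\<sigma> * (val w - val (prox_step \<sigma> w)))"
proof -
  let ?u = "prox \<sigma> J w" and ?w = "prox_step \<sigma> w"
  have w': "norm w = 1" "w \<in> eff_dom" "w \<in> (null_space J)\<^sup>\<bottom>" using w unfolding sphere_dom_def by auto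
  have s: "0 < s" using prox_nonzero[OF \<sigma> w'(1,2) c] unfolding s_def by simp
  have s1: "s \<le> 1" unfolding s_def by (rule norm_prox_le_1[OF \<sigma> w'(1)])
  have u: "?u = s *\<^sub>R ?w" using s unfolding prox_step_def s_def by simp
  show "?w \<in> sphere_dom"
    using s prox_dom[OF \<sigma>] prox_orthogonal[OF \<sigma> w'(3)] unfolding sphere_dom_def prox_step_def s_def
    by (auto intro!: scale_dom orthogonal_scale)
  show vu: "val ?u = s powr p * val ?w"
    by (subst u) (rule val_scale[OF less_imp_le[OF s]])
  have ineq: "s - ?u \<bullet> w \<le> s powr p * (\<sigma> * (val w - val ?w))"
    using prox_same_radius[OF \<sigma> w'(1,2)] unfolding vu s_def[symmetric] by (simp add: algebra_simps)
  have uw: "?u \<bullet> w \<le> s"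
    using norm_cauchy_schwarz[of ?u w] w'(1) unfolding s_def by simp
  have "0 \<le> s powr p * (\<sigma> * (val w - val ?w))" using ineq uw by linarith
  then have nn: "0 \<le> \<sigma> * (val w - val ?w)"
    using s by (simp add: zero_le_mult_iff)
  then show "val ?w \<le> val w" using \<sigma> by (simp add: zero_le_mult_iff)
  have "s powr p \<le> 1" using powr_le_self[of s] s s1 by linarith
  then have "s powr p * (\<sigma> * (val w - val ?w)) \<le> \<sigma> * (val w - val ?w)"
    using nn by (intro mult_left_le_one_le) auto
  then have *: "s - ?u \<bullet> w \<le> \<sigma> * (val w - val ?w)" using ineq by linarith
  have "w \<bullet> w = 1" using w'(1) by (simp flip: power2_norm_eq_inner)
  moreover have "?u \<bullet> ?u = s * s" unfolding s_def by (simp flip: power2_norm_eq_inner add: power2_eq_square)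
  ultimately have "(norm (?u - s *\<^sub>R w))\<^sup>2 = 2 * (s * (s - ?u \<bullet> w))"
    unfolding power2_norm_eq_inner
    by (simp add: inner_diff_left inner_diff_right inner_commute algebra_simps)
  moreover have "s * (s - ?u \<bullet> w) \<le> s - ?u \<bullet> w"
    using s s1 uw by (intro mult_left_le_one_le) auto
  ultimately show "(norm (?u - s *\<^sub>R w))\<^sup>2 \<le> 2 * (\<sigma> * (val w - val ?w))"
    using * by linarith
qed

text \<open>The first claim keeps the limit \<open>b\<close> of the values on the left, where lower semicontinuity would
  only leave the smaller \<open>val m\<close>. If \<open>\<tau> > 0\<close>, testing it with \<open>v = m\<close> shows that \<open>b\<close> is not
  larger than \<open>val m\<close>, so no value is lost in the limit.\<close>

lemma limit_minimizes:
  assumes \<sigma>n: "\<And>n. \<sigma> n > 0" and \<sigma>: "\<sigma> \<longlonglongrightarrow> \<tau>" and \<tau>: "\<tau> \<ge> 0"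
    and x: "x \<longlonglongrightarrow> l" and u: "(\<lambda>n. prox (\<sigma> n) J (x n)) \<longlonglongrightarrow> m"
    and val: "(\<lambda>n. val (prox (\<sigma> n) J (x n))) \<longlonglongrightarrow> b"
  shows "\<And>v. v \<in> eff_dom \<Longrightarrow> 1 / 2 * (norm (m - l))\<^sup>2 + \<tau> * b \<le> energy \<tau> l v"
    and "minimizes \<tau> l m"
proof -
  have Jm: "J m \<le> ereal b"
    by (rule lsc_limit[OF lsc u val]) (simp add: J_eq_val[OF prox_dom[OF \<sigma>n]])
  have d: "m \<in> eff_dom" and v: "val m \<le> b" using domI[OF Jm] val_le[OF Jm] .
  show le: "1 / 2 * (norm (m - l))\<^sup>2 + \<tau> * b \<le> energy \<tau> l v" if "v \<in> eff_dom" for v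
  proof (rule LIMSEQ_le)
    show "(\<lambda>n. energy (\<sigma> n) (x n) (prox (\<sigma> n) J (x n))) \<longlonglongrightarrow> 1 / 2 * (norm (m - l))\<^sup>2 + \<tau> * b"
      unfolding energy_def by (intro tendsto_intros \<sigma> x u val)
    show "(\<lambda>n. energy (\<sigma> n) (x n) v) \<longlonglongrightarrow> energy \<tau> l v"
      unfolding energy_def by (intro tendsto_intros \<sigma> x)
  qed (use prox_le[OF \<sigma>n that] in blast)
  have "energy \<tau> l m \<le> 1 / 2 * (norm (m - l))\<^sup>2 + \<tau> * b"
    unfolding energy_def using mult_left_mono[OF v \<tau>] by simp
  then show "minimizes \<tau> l m"
    unfolding minimizes_def using d le by force
qed

text \<open>Both step size rules are covered by admitting any convergent sequence of step sizes. The norms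
  \<open>s\<close> of the proximal points are included in the compactness argument so that the same subsequence
  provides \<open>\<mu>\<close> as their limit.\<close>

lemma prox_iteration_converges:
  fixes x :: "nat \<Rightarrow> 'a" and \<sigma> :: "nat \<Rightarrow> real"
  assumes iter: "\<And>k. x (Suc k) = prox_step (\<sigma> k) (x k)"
    and x: "\<And>k. x k \<in> sphere_dom" and pos: "\<And>k. \<sigma> k > 0"
    and c: "\<And>k. \<sigma> k * val (x k) \<le> c" "c < 1"
    and L: "(\<lambda>k. val (x k)) \<longlonglongrightarrow> L" and \<sigma>: "\<sigma> \<longlonglongrightarrow> \<tau>" and \<tau>: "\<tau> > 0"
  shows "\<exists>r l. strict_mono r \<and> (x \<circ> r) \<longlonglongrightarrow> l \<and> l \<in> (null_space J)\<^sup>\<bottom> \<and> val l = L \<and>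
    (\<exists>\<mu>\<in>{0<..<1}. \<mu> *\<^sub>R l = prox \<tau> J l)"
proof -
  define u where "u k = prox (\<sigma> k) J (x k)" for k
  define s where "s k = norm (u k)" for k
  note step = prox_step[OF pos x c, folded iter u_def s_def]
  have x': "norm (x k) = 1" "x k \<in> eff_dom" "x k \<in> (null_space J)\<^sup>\<bottom>" for k
    using x[of k] unfolding sphere_dom_def by auto
  have dec: "val (x k) \<le> val (x 0)" for k
    by (induction k) (auto intro: order_trans[OF step(3)])
  define K where "K = closure {u. ereal (norm u) + J u \<le> ereal (1 + val (x 0))}"
  have "x k \<in> K" for k
  proof -
    have "ereal (norm (x k)) + J (x k) \<le> ereal (1 + val (x 0))"
      using x'[of k] J_eq_val dec[of k] by simp
    then show ?thesis
      unfolding K_def by (intro subsetD[OF closure_subset] CollectI)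
  qed
  moreover have "s k \<in> {0..1}" for k
    unfolding s_def u_def using norm_prox_le_1[OF pos x'(1)] by simp
  ultimately have in_compact: "\<forall>k. (x k, s k) \<in> K \<times> {0..1}" by simp
  have "compact (K \<times> {0..1::real})"
    unfolding K_def by (intro compact_Times compact_bounded_sublevel compact_Icc)
  from seq_compactE[OF compact_imp_seq_compact[OF this] in_compact]
  obtain q r where r: "strict_mono r" and q: "((\<lambda>k. (x k, s k)) \<circ> r) \<longlonglongrightarrow> q"
    and qK: "q \<in> K \<times> {0..1}"
    by blast
  define l \<mu> where "l = fst q" and "\<mu> = snd q"
  have xl: "(\<lambda>k. x (r k)) \<longlonglongrightarrow> l" using tendsto_fst[OF q] unfolding l_def by (simp add: o_def)
  have s\<mu>: "(\<lambda>k. s (r k)) \<longlonglongrightarrow> \<mu>" using tendsto_snd[OF q] unfolding \<mu>_def by (simp add: o_def)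
  have \<mu>0: "0 \<le> \<mu>" using qK unfolding \<mu>_def by auto
  have L_r: "(\<lambda>k. val (x (r k))) \<longlonglongrightarrow> L" and L_Suc: "(\<lambda>k. val (x (Suc (r k)))) \<longlonglongrightarrow> L"
    and \<sigma>_r: "(\<lambda>k. \<sigma> (r k)) \<longlonglongrightarrow> \<tau>"
    using LIMSEQ_subseq_LIMSEQ[OF L r] LIMSEQ_subseq_LIMSEQ[OF LIMSEQ_Suc[OF L] r]
      LIMSEQ_subseq_LIMSEQ[OF \<sigma> r] by (simp_all add: o_def)
  have "(\<lambda>k. 2 * (\<sigma> (r k) * (val (x (r k)) - val (x (Suc (r k)))))) \<longlonglongrightarrow> 2 * (\<tau> * (L - L))"
    by (intro tendsto_intros \<sigma>_r L_r L_Suc)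
  then have bound_lim: "(\<lambda>k. 2 * (\<sigma> (r k) * (val (x (r k)) - val (x (Suc (r k)))))) \<longlonglongrightarrow> 0"
    by simp
  have "(\<lambda>k. (norm (u (r k) - s (r k) *\<^sub>R x (r k)))\<^sup>2) \<longlonglongrightarrow> 0"
    by (rule Lim_null_comparison[OF always_eventually bound_lim]) (simp add: step(4))
  then have "(\<lambda>k. u (r k) - s (r k) *\<^sub>R x (r k)) \<longlonglongrightarrow> 0"
    by (simp add: power_tendsto_0_iff tendsto_norm_zero_iff)
  from tendsto_add[OF this tendsto_scaleR[OF s\<mu> xl]] have u_lim: "(\<lambda>k. u (r k)) \<longlonglongrightarrow> \<mu> *\<^sub>R l" by simp
  have "(\<lambda>k. s (r k) powr p * val (x (Suc (r k)))) \<longlonglongrightarrow> \<mu> powr p * L"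
    using p_ge_1 by (intro tendsto_mult tendsto_powr' s\<mu> L_Suc tendsto_const) (auto simp: s_def)
  then have val_lim: "(\<lambda>k. val (u (r k))) \<longlonglongrightarrow> \<mu> powr p * L" by (simp add: step(2))
  have min: "minimizes \<tau> l (\<mu> *\<^sub>R l)"
    and below: "\<And>v. v \<in> eff_dom \<Longrightarrow> 1 / 2 * (norm (\<mu> *\<^sub>R l - l))\<^sup>2 + \<tau> * (\<mu> powr p * L) \<le> energy \<tau> l v"
    using limit_minimizes[OF pos \<sigma>_r less_imp_le[OF \<tau>] xl u_lim[unfolded u_def] val_lim[unfolded u_def]]
    by blast+
  have prox: "prox \<tau> J l = \<mu> *\<^sub>R l" by (rule prox_eq[OF \<tau> min])
  have Jl: "J l \<le> ereal L" by (rule lsc_limit[OF lsc xl L_r]) (simp add: J_eq_val x')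
  note l_dom = domI[OF Jl] and l_le = val_le[OF Jl]
  have l_norm: "norm l = 1"
    using tendsto_norm[OF xl] by (simp add: x' LIMSEQ_const_iff)
  have l_orth: "l \<in> (null_space J)\<^sup>\<bottom>" by (rule orthogonal_limit[OF xl x'(3)])
  have "\<tau> * L \<le> c"
    by (rule LIMSEQ_le_const2[OF tendsto_mult[OF \<sigma> L]]) (use c(1) in blast)
  then have "\<tau> * val l \<le> c" using mult_left_mono[OF l_le less_imp_le[OF \<tau>]] by linarith
  then have "\<mu> *\<^sub>R l \<noteq> 0" using prox_nonzero[OF \<tau> l_norm l_dom _ c(2)] prox by simp
  then have \<mu>_pos: "0 < \<mu>" using \<mu>0 by (cases "\<mu> = 0") auto
  have \<mu>_less: "\<mu> < 1" using norm_prox_less_1[OF \<tau> l_norm l_orth] prox l_norm \<mu>0 by simp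
  \<comment> \<open>Testing the limit inequality with the minimizer itself excludes a drop of \<open>J\<close> in the limit.\<close>
  have "\<tau> * (\<mu> powr p * L) \<le> \<tau> * (\<mu> powr p * val l)"
    using below[of "\<mu> *\<^sub>R l"] min val_scale[OF \<mu>0, of l] unfolding minimizes_def energy_def by simp
  then have "L \<le> val l" using \<tau> \<mu>_pos by simp
  then have "val l = L" using l_le by simp
  then show ?thesis
    using r xl l_orth prox \<mu>_pos \<mu>_less
    by (intro exI[of _ r] exI[of _ l]) (auto simp: o_def intro!: bexI[of _ \<mu>])
qed

end

theorem theorem3p5:
  fixes J :: "'a::{real_inner, complete_space} \<Rightarrow> ereal"
    and p C c :: real
    and w :: "nat \<Rightarrow> 'a"
    and step :: "'a \<Rightarrow> real"
  assumes "p \<ge> 1"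
    and "proper J" and "convex_functional J" and "lower_semicontinuous J"
    and "abs_homogeneous p J"
    and "precompact_sublevels (\<lambda>u. ereal (norm u) + J u)"
    and "C > 0"
    and "\<And>u. ereal (norm (u - orth_proj (null_space J) u) powr p) \<le> ereal C * J u"
    and "w 0 \<in> (null_space J)\<^sup>\<bottom>" and "norm (w 0) = 1" and "J (w 0) < \<infinity>"
    and "0 < c" and "c < 1"
    and "step = (\<lambda>u. c / real_of_ereal (J (w 0))) \<or> step = (\<lambda>u. c / real_of_ereal (J u))"
    and "\<And>k. w (Suc k) =
           (1 / norm (prox (step (w k)) J (w k))) *\<^sub>R prox (step (w k)) J (w k)"
  shows "\<exists>r w_inf. strict_mono r \<and> (w \<circ> r) \<longlonglongrightarrow> w_inf \<and> w_inf \<in> (null_space J)\<^sup>\<bottom> \<and>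
           (\<exists>\<mu>\<in>{0<..<1}. \<mu> *\<^sub>R w_inf = prox (step w_inf) J w_inf)"
proof -
  interpret poincare_functional J p C
    by unfold_locales fact+
  have step: "step = (\<lambda>u. c / val (w 0)) \<or> step = (\<lambda>u. c / val u)"
    using assms(14) unfolding val_def .
  have iter: "w (Suc k) = prox_step (step (w k)) (w k)" for k
    unfolding prox_step_def by (rule assms(15))
  have val_pos: "0 < val v" if "v \<in> sphere_dom" for v
    using val_sphere_lower[OF that] C_pos by (meson less_le_trans zero_less_divide_1_iff)
  have w0: "w 0 \<in> sphere_dom"
    using assms(9-11) unfolding sphere_dom_def eff_dom_def by simp
  have step_bounds: "0 < step v \<and> step v * val v \<le> c" if "v \<in> sphere_dom" "val v \<le> val (w 0)" for v
    using step val_pos[OF that(1)] val_pos[OF w0] that(2) \<open>0 < c\<close> by (auto simp: field_simps)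
  have inv: "w k \<in> sphere_dom \<and> val (w k) \<le> val (w 0)" for k
  proof (induction k)
    case (Suc k)
    then show ?case
      using prox_step(1,3)[of "step (w k)" "w k" c] step_bounds[of "w k"] \<open>c < 1\<close>
      unfolding iter by force
  qed (simp add: w0)
  have dec: "val (w (Suc k)) \<le> val (w k)" for k
    using prox_step(3)[of "step (w k)" "w k" c] step_bounds[of "w k"] inv[of k] \<open>c < 1\<close>
    unfolding iter by blast
  obtain L where L: "(\<lambda>k. val (w k)) \<longlonglongrightarrow> L" and L_lower: "1 / C \<le> L"
  proof -
    have "decseq (\<lambda>k. val (w k))" using dec by (rule decseq_SucI)
    then obtain L where "(\<lambda>k. val (w k)) \<longlonglongrightarrow> L"
      using decseq_convergent[of "\<lambda>k. val (w k)" 0] val_nonneg by metis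
    moreover from this have "1 / C \<le> L"
      by (rule LIMSEQ_le_const) (use inv val_sphere_lower in blast)
    ultimately show ?thesis using that by blast
  qed
  have L_pos: "0 < L" using L_lower C_pos by (meson less_le_trans zero_less_divide_1_iff)
  define \<tau> where "\<tau> = (if step = (\<lambda>u. c / val (w 0)) then c / val (w 0) else c / L)"
  have \<tau>_pos: "\<tau> > 0" unfolding \<tau>_def using \<open>0 < c\<close> L_pos val_pos[OF w0] by simp
  have \<tau>_lim: "(\<lambda>k. step (w k)) \<longlonglongrightarrow> \<tau>"
  proof (cases "step = (\<lambda>u. c / val (w 0))")
    case False
    then have "step = (\<lambda>u. c / val u)" using step by blast
    then show ?thesis
      using False L L_pos unfolding \<tau>_def by (auto intro!: tendsto_intros)
  qed (simp add: \<tau>_def)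
  have step_limit: "step l = \<tau>" if "val l = L" for l
    using step that unfolding \<tau>_def by auto
  obtain r l where "strict_mono r" "(w \<circ> r) \<longlonglongrightarrow> l" "l \<in> (null_space J)\<^sup>\<bottom>" "val l = L"
    "\<exists>\<mu>\<in>{0<..<1}. \<mu> *\<^sub>R l = prox \<tau> J l"
    using prox_iteration_converges[of w "\<lambda>k. step (w k)" c L \<tau>, OF iter] inv step_bounds
      \<open>c < 1\<close> L \<tau>_lim \<tau>_pos by metis
  then show ?thesis
    using step_limit by metis
qed

end
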